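(* Let $n\ge 1$ and let $S\subseteq\mathcal{L}(\mathbb{C}^2)$ and $T\subseteq\mathcal{L}(\mathbb{C}^n)$ be noncommutative graphs. If the one-shot zero-error classical capacity of $S$ and $T$ can be activated, i.e. if at least one of $\mathcal{C}_0^{(1)}(S)$, $\mathcal{C}_0^{(1)}(T)$ equals $0$ and $$\mathcal{C}_0^{(1)}(S\otimes T)>\mathcal{C}_0^{(1)}(S)+\mathcal{C}_0^{(1)}(T),$$ then $S=\mathbb{C}I_2$.
   Context: $\mathcal{L}(\mathbb{C}^n)$ is the space of linear operators ($n\times n$ complex matrices) on $\mathbb{C}^n$, with Hilbert–Schmidt inner product $\langle X,Y\rangle=\mathrm{Tr}(X^\dagger Y)$; $\perp$ refers to this inner product. A noncommutative graph is a complex linear subspace $S\subseteq\mathcal{L}(\mathbb{C}^n)$ with $S=S^\dagger$ (closed under conjugate transpose) and $I\in S$. For a noncommutative graph $S\subseteq\mathcal{L}(\mathbb{C}^n)$, let $\alpha(S)$ be the maximum number $m$ of nonzero vectors $|\psi_1\rangle,\dots,|\psi_m\rangle\in\mathbb{C}^n$ such that $|\psi_s\rangle\langle\psi_t|\perp S$ for all $s\ne t$ (such vectors are automatically pairwise orthogonal since $I\in S$). The one-shot zero-error classical capacity is $\mathcal{C}_0^{(1)}(S)=\log_2\alpha(S)$. $S\otimes T$ denotes the span of all $P\otimes Q$ with $P\in S$, $Q\in T$; it is again a noncommutative graph. $I_2$ is the $2\times2$ identity matrix. *)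

theory Defs
  imports "HOL-Analysis.Analysis"
begin

text \<open>
  The scalar multiplication that comes with \<^typ>\<open>complex^'n^'n\<close> is \<^const>\<open>scaleR\<close>, over the reals
  only; complex subspaces and spans are those of the following complex vector space.
\<close>

definition mscale :: "complex \<Rightarrow> complex^'n^'m \<Rightarrow> complex^'n^'m" (infixr "*\<^sub>M" 75)
  where "c *\<^sub>M A = map_matrix ((*) c) A"

global_interpretation cmat: vector_space "mscale :: complex \<Rightarrow> complex^'n^'m \<Rightarrow> complex^'n^'m"
  by standard (simp_all add: mscale_def vec_eq_iff algebra_simps)

definition dagger :: "complex^'n^'m \<Rightarrow> complex^'m^'n"
  where "dagger A = map_matrix cnj (transpose A)"

definition hs_inner :: "complex^'n^'n \<Rightarrow> complex^'n^'n \<Rightarrow> complex"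
  where "hs_inner X Y = trace (dagger X ** Y)"

definition ketbra :: "complex^'n \<Rightarrow> complex^'n \<Rightarrow> complex^'n^'n"
  where "ketbra u v = (\<chi> i j. u $ i * cnj (v $ j))"

definition hs_orthogonal :: "complex^'n^'n \<Rightarrow> (complex^'n^'n) set \<Rightarrow> bool" (infix "\<bottom>\<^sub>S" 50)
  where "X \<bottom>\<^sub>S S \<longleftrightarrow> (\<forall>Y\<in>S. hs_inner X Y = 0)"

definition noncommutative_graph :: "(complex^'n^'n) set \<Rightarrow> bool"
  where "noncommutative_graph S \<longleftrightarrow> cmat.subspace S \<and> dagger ` S = S \<and> mat 1 \<in> S"

definition zero_error_sizes :: "(complex^'n^'n) set \<Rightarrow> nat set"
  where "zero_error_sizes S =
    {m. \<exists>\<psi> :: nat \<Rightarrow> complex^'n.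
          (\<forall>s<m. \<psi> s \<noteq> 0) \<and> (\<forall>s<m. \<forall>t<m. s \<noteq> t \<longrightarrow> ketbra (\<psi> s) (\<psi> t) \<bottom>\<^sub>S S)}"

definition alpha :: "(complex^'n^'n) set \<Rightarrow> nat"
  where "alpha S = Max (zero_error_sizes S)"

definition zero_error_capacity :: "(complex^'n^'n) set \<Rightarrow> real"
  where "zero_error_capacity S = log 2 (real (alpha S))"

text \<open>The space \<open>\<complex>\<^sup>m \<otimes> \<complex>\<^sup>n\<close> is represented by vectors indexed by pairs.\<close>

definition kron :: "complex^'m^'m \<Rightarrow> complex^'n^'n \<Rightarrow> complex^('m \<times> 'n)^('m \<times> 'n)" (infixr "\<otimes>\<^sub>M" 70)
  where "P \<otimes>\<^sub>M Q = (\<chi> i j. P $ fst i $ fst j * Q $ snd i $ snd j)"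

definition graph_tensor ::
  "(complex^'m^'m) set \<Rightarrow> (complex^'n^'n) set \<Rightarrow> (complex^('m \<times> 'n)^('m \<times> 'n)) set"
  (infixr "\<otimes>\<^sub>S" 70)
  where "S \<otimes>\<^sub>S T = cmat.span {P \<otimes>\<^sub>M Q | P Q. P \<in> S \<and> Q \<in> T}"

definition capacity_activated :: "(complex^'m^'m) set \<Rightarrow> (complex^'n^'n) set \<Rightarrow> bool"
  where "capacity_activated S T \<longleftrightarrow>
    (zero_error_capacity S = 0 \<or> zero_error_capacity T = 0) \<and>
    zero_error_capacity (S \<otimes>\<^sub>S T) > zero_error_capacity S + zero_error_capacity T"


text \<open>
  For a noncommutative graph the maximum defining \<^const>\<open>alpha\<close> is taken over a finite nonempty set
  containing \<open>1\<close>, so it is attained and at least \<open>1\<close>.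
\<close>

lemma hs_inner_ketbra_mat1:
  fixes u v :: "complex^'n"
  shows "hs_inner (ketbra u v) (mat 1) = (\<Sum>i\<in>UNIV. cnj (u $ i) * v $ i)"
  by (simp add: hs_inner_def ketbra_def dagger_def trace_def transpose_def mult.commute)

lemma finite_zero_error_sizes:
  fixes S :: "(complex^'n^'n) set"
  assumes "mat 1 \<in> S"
  shows "finite (zero_error_sizes S)"
proof (rule finite_subset)
  show "zero_error_sizes S \<subseteq> {..DIM(complex^'n)}"
  proof
    fix m assume "m \<in> zero_error_sizes S"
    then obtain \<psi> :: "nat \<Rightarrow> complex^'n" where nz: "\<And>s. s < m \<Longrightarrow> \<psi> s \<noteq> 0"
      and orth: "\<And>s t. s < m \<Longrightarrow> t < m \<Longrightarrow> s \<noteq> t \<Longrightarrow> ketbra (\<psi> s) (\<psi> t) \<bottom>\<^sub>S S"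
      unfolding zero_error_sizes_def by blast
    have ip: "\<psi> s \<bullet> \<psi> t = 0" if "s < m" "t < m" "s \<noteq> t" for s t
    proof -
      have "(\<Sum>i\<in>UNIV. cnj (\<psi> s $ i) * \<psi> t $ i) = 0"
        using orth[OF that] assms unfolding hs_orthogonal_def
        by (simp flip: hs_inner_ketbra_mat1)
      then have "Re (\<Sum>i\<in>UNIV. cnj (\<psi> s $ i) * \<psi> t $ i) = 0" by simp
      then show ?thesis by (simp add: inner_vec_def inner_complex_def)
    qed
    have inj: "inj_on \<psi> {..<m}"
      using ip nz by (metis inj_onI inner_eq_zero_iff lessThan_iff)
    have "pairwise orthogonal (\<psi> ` {..<m})"
      using ip by (auto simp: pairwise_def orthogonal_def)
    then have "independent (\<psi> ` {..<m})"
      by (rule pairwise_orthogonal_independent) (use nz in auto)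
    then have "card (\<psi> ` {..<m}) \<le> DIM(complex^'n)"
      by (rule independent_bound[THEN conjunct2])
    then show "m \<in> {..DIM(complex^'n)}" by (simp add: card_image[OF inj])
  qed
qed simp

lemma one_in_zero_error_sizes: "1 \<in> zero_error_sizes S"
  unfolding zero_error_sizes_def by (auto intro!: exI[of _ "\<lambda>_. 1"] simp: vec_eq_iff)

lemma alpha_attained:
  assumes "noncommutative_graph S"
  shows "alpha S \<in> zero_error_sizes S" and "alpha S \<ge> 1"
    and "\<And>m. m \<in> zero_error_sizes S \<Longrightarrow> m \<le> alpha S"
proof -
  have fin: "finite (zero_error_sizes S)"
    using assms finite_zero_error_sizes by (auto simp: noncommutative_graph_def)
  show "alpha S \<in> zero_error_sizes S"
    unfolding alpha_def using fin one_in_zero_error_sizes by (intro Max_in) blast+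
  show le: "m \<le> alpha S" if "m \<in> zero_error_sizes S" for m
    unfolding alpha_def using fin that by (rule Max_ge)
  show "alpha S \<ge> 1" using le one_in_zero_error_sizes by blast
qed

lemma noncommutative_graph_tensor:
  assumes "noncommutative_graph S" "noncommutative_graph T"
  shows "noncommutative_graph (S \<otimes>\<^sub>S T)"
proof -
  let ?B = "{P \<otimes>\<^sub>M Q | P Q. P \<in> S \<and> Q \<in> T}"
  have dag_dag: "dagger (dagger A) = A" for A :: "complex^('a \<times> 'b)^('a \<times> 'b)"
    by (simp add: dagger_def transpose_def vec_eq_iff)
  have dag_kron: "dagger (P \<otimes>\<^sub>M Q) = dagger P \<otimes>\<^sub>M dagger Q" for P :: "complex^'a^'a" and Q :: "complex^'b^'b"
    by (simp add: dagger_def kron_def transpose_def vec_eq_iff)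
  have in_dag: "dagger A \<in> S \<otimes>\<^sub>S T" if "A \<in> S \<otimes>\<^sub>S T" for A
    using that unfolding graph_tensor_def
  proof (induction rule: cmat.span_induct_alt)
    case base
    have "dagger (0 :: complex^('a \<times> 'b)^('a \<times> 'b)) = 0"
      by (simp add: dagger_def transpose_def vec_eq_iff)
    then show ?case by (simp add: cmat.span_zero)
  next
    case (step c x y)
    have "dagger x \<in> ?B"
      using step(1) assms dag_kron unfolding noncommutative_graph_def by blast
    moreover have "dagger (c *\<^sub>M x + y) = cnj c *\<^sub>M dagger x + dagger y"
      by (simp add: dagger_def mscale_def transpose_def vec_eq_iff)
    ultimately show ?case
      using step by (simp add: cmat.span_add cmat.span_scale cmat.span_base)
  qed
  have "mat 1 = (mat 1 :: complex^'a^'a) \<otimes>\<^sub>M (mat 1 :: complex^'b^'b)"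
    by (auto simp: mat_def kron_def vec_eq_iff prod_eq_iff)
  then have "mat 1 \<in> S \<otimes>\<^sub>S T"
    using assms unfolding graph_tensor_def noncommutative_graph_def by (blast intro: cmat.span_base)
  moreover have "dagger ` (S \<otimes>\<^sub>S T) = S \<otimes>\<^sub>S T"
    using in_dag dag_dag by (metis (no_types, lifting) image_subset_iff subsetI subset_antisym image_eqI)
  ultimately show ?thesis
    unfolding noncommutative_graph_def by (simp add: graph_tensor_def)
qed

end

theory Submission
  imports Defs
begin

text \<open>
  If \<open>|\<phi>\<rangle>\<langle>\<phi>| \<in> S\<close>, then contracting the first tensor factor with \<open>\<langle>\<phi>|\<close> maps a family that is
  independent for \<open>S \<otimes> T\<close> to a family that is independent for \<open>T\<close>, up to vectors that become zero;
  for \<open>S\<close> on a qubit, no nonzero vector is killed by two linearly independent \<open>\<phi>\<close>.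
  A graph \<open>S \<noteq> \<complex>I\<close> on a qubit contains a singular nonzero Hermitian matrix, hence
  \<open>|\<phi>\<rangle>\<langle>\<phi>|\<close> and \<open>|\<phi>'\<rangle>\<langle>\<phi>'|\<close> for some orthogonal \<open>\<phi>, \<phi>'\<close>, and so \<open>\<alpha>(S \<otimes> T) \<le> 2 \<alpha>(T)\<close>. If
  moreover \<open>\<alpha>(S) = 1\<close>, then \<open>S\<close> has an element that is not diagonal in the basis \<open>\<phi>, \<phi>'\<close> and
  so contains infinitely many pairwise independent \<open>|\<phi>\<rangle>\<langle>\<phi>|\<close>; one of them kills no vector of the
  family, and \<open>\<alpha>(S \<otimes> T) \<le> \<alpha>(T)\<close>. In both cases \<open>\<alpha>(S \<otimes> T) \<le> \<alpha>(S) \<alpha>(T)\<close>.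
\<close>

section \<open>Hilbert-Schmidt products and conjugate transposes\<close>

lemma hs_inner_ketbra:
  "hs_inner (ketbra u v) Y = (\<Sum>i\<in>UNIV. \<Sum>j\<in>UNIV. cnj (u $ i) * Y $ i $ j * v $ j)"
proof -
  have "hs_inner (ketbra u v) Y = (\<Sum>j\<in>UNIV. \<Sum>i\<in>UNIV. cnj (u $ i) * Y $ i $ j * v $ j)"
    by (simp add: hs_inner_def ketbra_def dagger_def trace_def transpose_def
        matrix_matrix_mult_def mult_ac)
  then show ?thesis by (subst sum.swap)
qed

lemma hs_inner_ketbra_dagger:
  "hs_inner (ketbra u v) (dagger Y) = cnj (hs_inner (ketbra v u) Y)"
  by (simp add: hs_inner_ketbra dagger_def transpose_def mult_ac, subst sum.swap, rule refl)

lemma hs_inner_add_right: "hs_inner X (Y + Z) = hs_inner X Y + hs_inner X Z"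
  by (simp add: hs_inner_def matrix_add_ldistrib trace_add)

lemma hs_inner_mscale_right: "hs_inner X (c *\<^sub>M Y) = c * hs_inner X Y"
  by (simp add: hs_inner_def mscale_def trace_def matrix_matrix_mult_def sum_distrib_left mult_ac)

lemma dagger_add: "dagger (A + B) = dagger A + dagger B"
  by (simp add: dagger_def transpose_def vec_eq_iff)

lemma dagger_mscale: "dagger (c *\<^sub>M A) = cnj c *\<^sub>M dagger A"
  by (simp add: dagger_def mscale_def transpose_def vec_eq_iff)

lemma dagger_dagger: "dagger (dagger A) = A"
  by (simp add: dagger_def transpose_def vec_eq_iff)

text \<open>Families indexed by any finite set, such as the surviving contracted vectors or a pair
  indexed by \<open>bool\<close>, thus need no renumbering.\<close>

lemma card_in_zero_error_sizes:
  fixes \<psi> :: "'a \<Rightarrow> complex^'n"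
  assumes "finite A" and nz: "\<And>s. s \<in> A \<Longrightarrow> \<psi> s \<noteq> 0"
    and orth: "\<And>s t. s \<in> A \<Longrightarrow> t \<in> A \<Longrightarrow> s \<noteq> t \<Longrightarrow> ketbra (\<psi> s) (\<psi> t) \<bottom>\<^sub>S S"
  shows "card A \<in> zero_error_sizes S"
proof -
  obtain h where h: "bij_betw h {..<card A} A"
    using ex_bij_betw_nat_finite[OF \<open>finite A\<close>] by (auto simp: atLeast0LessThan)
  have hA: "h s \<in> A" if "s < card A" for s
    using h that by (auto simp: bij_betw_def)
  have hne: "h s \<noteq> h t" if "s < card A" "t < card A" "s \<noteq> t" for s t
    using h that by (auto simp: bij_betw_def inj_on_def)
  show ?thesis
    unfolding zero_error_sizes_def
    by (auto intro!: exI[of _ "\<lambda>s. \<psi> (h s)"] nz orth simp: hA hne)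
qed

section \<open>Contraction of the first tensor factor\<close>

definition contract :: "complex^'m \<Rightarrow> complex^('m \<times> 'n) \<Rightarrow> complex^'n"
  where "contract \<phi> \<psi> = (\<chi> k. \<Sum>i\<in>UNIV. cnj (\<phi> $ i) * \<psi> $ (i, k))"

lemma sum_UNIV_prod: "(\<Sum>x\<in>UNIV. f x) = (\<Sum>i\<in>UNIV. \<Sum>j\<in>UNIV. f (i, j))"
  by (simp add: sum.cartesian_product)

text \<open>Both sides are \<open>\<langle>\<psi>| (|\<phi>\<rangle>\<langle>\<phi>| \<otimes> Q)
  |\<xi>\<rangle>\<close>, written out in coordinates; the proof reorders a fourfold sum.\<close>

lemma hs_inner_contract:
  "hs_inner (ketbra (contract \<phi> \<psi>) (contract \<phi> \<xi>)) Q
    = hs_inner (ketbra \<psi> \<xi>) (ketbra \<phi> \<phi> \<otimes>\<^sub>M Q)"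
proof -
  have kron_entry: "(ketbra \<phi> \<phi> \<otimes>\<^sub>M Q) $ (i, k) $ (j, l) = \<phi> $ i * cnj (\<phi> $ j) * Q $ k $ l" for i j k l
    by (simp add: kron_def ketbra_def)
  have "hs_inner (ketbra (contract \<phi> \<psi>) (contract \<phi> \<xi>)) Q
    = (\<Sum>k\<in>UNIV. \<Sum>l\<in>UNIV. \<Sum>i\<in>UNIV. \<Sum>j\<in>UNIV.
        cnj (\<psi> $ (i, k)) * (\<phi> $ i * cnj (\<phi> $ j) * Q $ k $ l) * \<xi> $ (j, l))"
    by (simp add: hs_inner_ketbra contract_def sum_distrib_left sum_distrib_right mult_ac)
  also have "\<dots> = (\<Sum>k\<in>UNIV. \<Sum>i\<in>UNIV. \<Sum>l\<in>UNIV. \<Sum>j\<in>UNIV.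
        cnj (\<psi> $ (i, k)) * (\<phi> $ i * cnj (\<phi> $ j) * Q $ k $ l) * \<xi> $ (j, l))"
    by (intro sum.cong refl sum.swap)
  also have "\<dots> = (\<Sum>i\<in>UNIV. \<Sum>k\<in>UNIV. \<Sum>l\<in>UNIV. \<Sum>j\<in>UNIV.
        cnj (\<psi> $ (i, k)) * (\<phi> $ i * cnj (\<phi> $ j) * Q $ k $ l) * \<xi> $ (j, l))"
    by (rule sum.swap)
  also have "\<dots> = (\<Sum>i\<in>UNIV. \<Sum>k\<in>UNIV. \<Sum>j\<in>UNIV. \<Sum>l\<in>UNIV.
        cnj (\<psi> $ (i, k)) * (\<phi> $ i * cnj (\<phi> $ j) * Q $ k $ l) * \<xi> $ (j, l))"
    by (intro sum.cong refl sum.swap)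
  also have "\<dots> = hs_inner (ketbra \<psi> \<xi>) (ketbra \<phi> \<phi> \<otimes>\<^sub>M Q)"
    by (simp add: hs_inner_ketbra kron_entry sum_UNIV_prod)
  finally show ?thesis .
qed

lemma card_contract_le_alpha:
  fixes \<psi> :: "nat \<Rightarrow> complex^('m::finite \<times> 'n::finite)"
    and S :: "(complex^'m^'m) set" and T :: "(complex^'n^'n) set"
  assumes T: "noncommutative_graph T" and \<phi>: "ketbra \<phi> \<phi> \<in> S"
    and orth: "\<And>s t. s < m \<Longrightarrow> t < m \<Longrightarrow> s \<noteq> t \<Longrightarrow> ketbra (\<psi> s) (\<psi> t) \<bottom>\<^sub>S S \<otimes>\<^sub>S T"
  shows "card {s. s < m \<and> contract \<phi> (\<psi> s) \<noteq> 0} \<le> alpha T"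
proof (rule alpha_attained(3)[OF T], rule card_in_zero_error_sizes)
  fix s t assume "s \<in> {s. s < m \<and> contract \<phi> (\<psi> s) \<noteq> 0}" "t \<in> {s. s < m \<and> contract \<phi> (\<psi> s) \<noteq> 0}" "s \<noteq> t"
  then have o: "ketbra (\<psi> s) (\<psi> t) \<bottom>\<^sub>S S \<otimes>\<^sub>S T" using orth by blast
  have "ketbra \<phi> \<phi> \<otimes>\<^sub>M Q \<in> S \<otimes>\<^sub>S T" if "Q \<in> T" for Q
    unfolding graph_tensor_def using \<phi> that by (blast intro: cmat.span_base)
  then show "ketbra (contract \<phi> (\<psi> s)) (contract \<phi> (\<psi> t)) \<bottom>\<^sub>S T"
    using o by (auto simp: hs_orthogonal_def hs_inner_contract)
qed auto

text \<open>For each \<open>k\<close>, the entries \<open>\<psi> $ (1, k)\<close> and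
  \<open>\<psi> $ (2, k)\<close> solve a homogeneous 2 by 2 system whose determinant is the
  conjugate of that of \<open>\<phi>\<close>, \<open>\<phi>'\<close>.\<close>

lemma contract_2_eq_0:
  fixes \<phi> \<phi>' :: "complex^2"
  assumes "\<phi> $ 1 * \<phi>' $ 2 \<noteq> \<phi> $ 2 * \<phi>' $ 1" "contract \<phi> \<psi> = 0" "contract \<phi>' \<psi> = 0"
  shows "\<psi> = 0"
proof -
  define a b c d where "a = cnj (\<phi> $ 1)" "b = cnj (\<phi> $ 2)" "c = cnj (\<phi>' $ 1)" "d = cnj (\<phi>' $ 2)"
  note abcd = this
  have "cnj (\<phi> $ 1 * \<phi>' $ 2) \<noteq> cnj (\<phi> $ 2 * \<phi>' $ 1)"
    using assms(1) by (simp only: complex_cnj_cancel_iff not_False_eq_True)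
  then have det: "a * d - b * c \<noteq> 0" by (simp add: abcd)
  have "\<psi> $ (1, k) = 0 \<and> \<psi> $ (2, k) = 0" for k
  proof -
    have e: "a * \<psi> $ (1, k) + b * \<psi> $ (2, k) = 0" "c * \<psi> $ (1, k) + d * \<psi> $ (2, k) = 0"
      using assms(2,3) by (simp_all add: contract_def vec_eq_iff sum_2 abcd)
    then have "(a * d - b * c) * \<psi> $ (1, k) = 0" "(a * d - b * c) * \<psi> $ (2, k) = 0"
      by algebra+
    then show ?thesis using det by simp
  qed
  then have "\<psi> $ p = 0" for p
    using exhaust_2[of "fst p"] by (cases p) auto
  then show ?thesis by (simp add: vec_eq_iff)
qed

section \<open>Rank-one elements of a qubit graph\<close>

lemma noncommutative_graph_closed:
  assumes "noncommutative_graph S"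
  shows "cmat.subspace S" "A \<in> S \<Longrightarrow> dagger A \<in> S" "c *\<^sub>M mat 1 \<in> S"
  using assms by (auto simp: noncommutative_graph_def cmat.subspace_scale)

text \<open>Such an \<open>H\<close> has rank one, so \<open>\<phi>\<close> can be its first column
  scaled to leading entry 1, or the second basis vector if that column vanishes.\<close>

lemma singular_hermitian_2_eq_ketbra:
  fixes H :: "complex^2^2"
  assumes "dagger H = H" "H \<noteq> 0" "H $ 1 $ 1 * H $ 2 $ 2 = H $ 1 $ 2 * H $ 2 $ 1"
  obtains \<phi> c where "\<phi> \<noteq> 0" "ketbra \<phi> \<phi> = c *\<^sub>M H"
proof -
  have h: "cnj (H $ 1 $ 1) = H $ 1 $ 1" "cnj (H $ 2 $ 2) = H $ 2 $ 2"
    "cnj (H $ 1 $ 2) = H $ 2 $ 1" "cnj (H $ 2 $ 1) = H $ 1 $ 2"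
    using assms(1) by (auto simp: dagger_def transpose_def vec_eq_iff forall_2)
  show thesis
  proof (cases "H $ 1 $ 1 = 0")
    case True
    then have "H $ 1 $ 2 = 0 \<and> H $ 2 $ 1 = 0" using assms(3) h by auto
    moreover from this have "H $ 2 $ 2 \<noteq> 0"
      using assms(2) True by (auto simp: vec_eq_iff forall_2)
    ultimately show thesis using True
      by (intro that[of "vector [0, 1]" "inverse (H $ 2 $ 2)"])
        (auto simp: vec_eq_iff forall_2 ketbra_def mscale_def)
  next
    case False
    then have d: "H $ 2 $ 2 = H $ 1 $ 2 * H $ 2 $ 1 / H $ 1 $ 1"
      using assms(3) by (metis nonzero_mult_div_cancel_left)
    show thesis
    proof (rule that)
      show "vector [1, H $ 2 $ 1 / H $ 1 $ 1] \<noteq> (0 :: complex^2)"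
        by (simp add: vec_eq_iff forall_2)
      show "ketbra (vector [1, H $ 2 $ 1 / H $ 1 $ 1]) (vector [1, H $ 2 $ 1 / H $ 1 $ 1])
          = (1 / H $ 1 $ 1) *\<^sub>M H"
        using False by (simp add: vec_eq_iff forall_2 ketbra_def mscale_def h(1,4) d)
    qed
  qed
qed

text \<open>The witness \<open>l\<close> is the smaller eigenvalue of \<open>H\<close>, real because
  the discriminant \<open>D\<^sup>2\<close> of the characteristic polynomial is a sum of
  squares.\<close>

lemma hermitian_2_singular_shift:
  fixes H :: "complex^2^2"
  assumes "dagger H = H"
  obtains l :: real where "(H $ 1 $ 1 - l) * (H $ 2 $ 2 - l) = H $ 1 $ 2 * H $ 2 $ 1"
proof -
  have h: "cnj (H $ 1 $ 1) = H $ 1 $ 1" "cnj (H $ 2 $ 2) = H $ 2 $ 2" "H $ 2 $ 1 = cnj (H $ 1 $ 2)"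
    using assms by (auto simp: dagger_def transpose_def vec_eq_iff forall_2)
  obtain a d where ad: "H $ 1 $ 1 = complex_of_real a" "H $ 2 $ 2 = complex_of_real d"
    using h(1,2) by (metis Reals_cases Reals_cnj_iff)
  define D where "D = sqrt ((a - d)\<^sup>2 + 4 * (cmod (H $ 1 $ 2))\<^sup>2)"
  have D: "D\<^sup>2 = (a - d)\<^sup>2 + 4 * (cmod (H $ 1 $ 2))\<^sup>2" by (simp add: D_def)
  define l where "l = (a + d - D) / 2"
  have "(a - l) * (d - l) = (D\<^sup>2 - (a - d)\<^sup>2) / 4"
    by (simp add: l_def power2_eq_square field_simps)
  then have "(a - l) * (d - l) = (cmod (H $ 1 $ 2))\<^sup>2" by (simp add: D)
  then have "complex_of_real ((a - l) * (d - l)) = H $ 1 $ 2 * cnj (H $ 1 $ 2)"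
    by (simp only: complex_norm_square)
  then have "(H $ 1 $ 1 - l) * (H $ 2 $ 2 - l) = H $ 1 $ 2 * H $ 2 $ 1"
    by (simp only: ad h(3) of_real_mult of_real_diff)
  then show thesis by (rule that)
qed

text \<open>One of the Hermitian matrices \<open>Y + Y\<^sup>\<dagger>\<close> and \<open>\<i>(Y - Y\<^sup>\<dagger>)\<close> has a nonzero value under any linear
  functional not vanishing on \<open>Y\<close>.\<close>

lemma hermitian_witness:
  assumes S: "noncommutative_graph S" and "Y \<in> S" "f Y \<noteq> (0::complex)"
    and add: "\<And>A B. f (A + B) = f A + f B" and scale: "\<And>c A. f (c *\<^sub>M A) = c * f A"
  obtains H where "H \<in> S" "dagger H = H" "f H \<noteq> 0"
proof -
  note cl = noncommutative_graph_closed[OF S]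
  define G where "G = \<i> *\<^sub>M Y + (- \<i>) *\<^sub>M dagger Y"
  have mem: "Y + dagger Y \<in> S" "G \<in> S"
    unfolding G_def using cl(1) \<open>Y \<in> S\<close> cl(2)[OF \<open>Y \<in> S\<close>]
    by (simp_all only: cmat.subspace_add cmat.subspace_scale)
  have herm: "dagger (Y + dagger Y) = Y + dagger Y" "dagger G = G"
    unfolding G_def dagger_add dagger_mscale dagger_dagger by (simp_all add: add.commute)
  have "2 * f Y = f (Y + dagger Y) - \<i> * f G"
    unfolding G_def add scale by (simp add: algebra_simps)
  then have "f (Y + dagger Y) \<noteq> 0 \<or> f G \<noteq> 0" using \<open>f Y \<noteq> 0\<close> by auto
  then show thesis using that mem herm by blast
qed

lemma rank_one_in_qubit_graph:
  fixes S :: "(complex^2^2) set"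
  assumes S: "noncommutative_graph S" and ne: "S \<noteq> {c *\<^sub>M mat 1 | c. True}"
  obtains \<phi> where "\<phi> \<noteq> 0" "ketbra \<phi> \<phi> \<in> S"
proof -
  note cl = noncommutative_graph_closed[OF S]
  have scalar_iff: "(\<exists>c. A = c *\<^sub>M mat 1) \<longleftrightarrow> A $ 1 $ 1 = A $ 2 $ 2 \<and> A $ 1 $ 2 = 0 \<and> A $ 2 $ 1 = 0"
    for A :: "complex^2^2"
    by (auto simp: mscale_def mat_def vec_eq_iff forall_2)
  obtain Y where Y: "Y \<in> S" "\<nexists>c. Y = c *\<^sub>M mat 1"
    using ne cl(3) by blast
  \<comment> \<open>The functional \<open>f\<close> certifies that a matrix is not scalar, and its
    value is unchanged by adding a multiple of the identity.\<close>
  obtain f :: "complex^2^2 \<Rightarrow> complex" where f: "f Y \<noteq> 0" "f (mat 1) = 0"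
    "\<And>A B. f (A + B) = f A + f B" "\<And>c A. f (c *\<^sub>M A) = c * f A"
  proof -
    consider "Y $ 1 $ 1 - Y $ 2 $ 2 \<noteq> 0" | "Y $ 1 $ 2 \<noteq> 0" | "Y $ 2 $ 1 \<noteq> 0"
      using Y(2) unfolding scalar_iff by auto
    then show thesis
    proof cases
      case 1 then show thesis
        by (intro that[of "\<lambda>A. A $ 1 $ 1 - A $ 2 $ 2"]) (auto simp: mscale_def mat_def algebra_simps)
    next
      case 2 then show thesis
        by (intro that[of "\<lambda>A. A $ 1 $ 2"]) (auto simp: mscale_def mat_def)
    next
      case 3 then show thesis
        by (intro that[of "\<lambda>A. A $ 2 $ 1"]) (auto simp: mscale_def mat_def)
    qed
  qed
  obtain H where H: "H \<in> S" "dagger H = H" "f H \<noteq> 0"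
    using hermitian_witness[where f = f, OF S Y(1) f(1)] f(3,4) by blast
  obtain l :: real where l: "(H $ 1 $ 1 - l) * (H $ 2 $ 2 - l) = H $ 1 $ 2 * H $ 2 $ 1"
    using hermitian_2_singular_shift[OF H(2)] by blast
  \<comment> \<open>The shift by an eigenvalue makes \<open>K\<close> singular, while
    \<open>f\<close> keeps it nonzero.\<close>
  define K where "K = H + (- complex_of_real l) *\<^sub>M mat 1"
  have "K \<in> S"
    unfolding K_def by (intro cmat.subspace_add[OF cl(1)] H(1) cl(3))
  have "dagger K = K"
  proof -
    have "dagger (mat 1 :: complex^2^2) = mat 1"
      by (simp add: dagger_def transpose_def mat_def vec_eq_iff)
    then show ?thesis unfolding K_def dagger_add dagger_mscale H(2) by simp
  qed
  moreover have "f K = f H" by (simp only: K_def f) simp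
  have "f 0 = 0" using f(4)[of 0 0] by (simp add: cmat.scale_zero_left)
  then have "K \<noteq> 0" using \<open>f K = f H\<close> H(3) by auto
  moreover have "K $ 1 $ 1 * K $ 2 $ 2 = K $ 1 $ 2 * K $ 2 $ 1"
    using l by (simp add: K_def mscale_def mat_def)
  ultimately obtain \<phi> c where "\<phi> \<noteq> 0" "ketbra \<phi> \<phi> = c *\<^sub>M K"
    using singular_hermitian_2_eq_ketbra by blast
  then show thesis
    using that[of \<phi>] \<open>K \<in> S\<close> cl(1) by (simp add: cmat.subspace_scale)
qed

definition perp :: "complex^2 \<Rightarrow> complex^2"
  where "perp \<phi> = vector [- cnj (\<phi> $ 2), cnj (\<phi> $ 1)]"

definition sqnorm :: "complex^2 \<Rightarrow> complex"
  where "sqnorm \<phi> = \<phi> $ 1 * cnj (\<phi> $ 1) + \<phi> $ 2 * cnj (\<phi> $ 2)"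

lemma sqnorm_eq_0_iff: "sqnorm \<phi> = 0 \<longleftrightarrow> \<phi> = 0"
proof -
  have "sqnorm \<phi> = complex_of_real ((cmod (\<phi> $ 1))\<^sup>2 + (cmod (\<phi> $ 2))\<^sup>2)"
    by (simp only: sqnorm_def complex_norm_square of_real_add)
  also have "\<dots> = 0 \<longleftrightarrow> \<phi> = 0"
    unfolding of_real_eq_0_iff by (simp add: sum_power2_eq_zero_iff vec_eq_iff forall_2)
  finally show ?thesis .
qed

text \<open>This is the completeness relation of the orthogonal basis \<open>\<phi>\<close>,
  \<open>perp \<phi>\<close>, whose vectors have equal norm.\<close>

lemma ketbra_perp: "ketbra (perp \<phi>) (perp \<phi>) = sqnorm \<phi> *\<^sub>M mat 1 - ketbra \<phi> \<phi>"
  by (simp add: ketbra_def perp_def sqnorm_def mscale_def mat_def vec_eq_iff forall_2)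

lemma det_perp: "\<phi> $ 1 * perp \<phi> $ 2 - \<phi> $ 2 * perp \<phi> $ 1 = sqnorm \<phi>"
  by (simp add: perp_def sqnorm_def)

text \<open>The coefficients are the matrix entries of \<open>X\<close> in the basis
  \<open>\<phi>\<close>, \<open>perp \<phi>\<close>; the factor on the left makes up for the missing
  normalization.\<close>

lemma expand_in_perp_basis:
  fixes X :: "complex^2^2"
  defines "x \<equiv> \<lambda>u v. hs_inner (ketbra u v) X"
  shows "(sqnorm \<phi> * sqnorm \<phi>) *\<^sub>M X =
    x \<phi> \<phi> *\<^sub>M ketbra \<phi> \<phi> + x \<phi> (perp \<phi>) *\<^sub>M ketbra \<phi> (perp \<phi>)
    + x (perp \<phi>) \<phi> *\<^sub>M ketbra (perp \<phi>) \<phi> + x (perp \<phi>) (perp \<phi>) *\<^sub>M ketbra (perp \<phi>) (perp \<phi>)"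
  unfolding x_def hs_inner_ketbra
  by (simp add: ketbra_def perp_def sqnorm_def mscale_def vec_eq_iff forall_2 sum_2 algebra_simps)

lemma ketbra_perp_in_graph:
  assumes "noncommutative_graph S" "ketbra \<phi> \<phi> \<in> S"
  shows "ketbra (perp \<phi>) (perp \<phi>) \<in> S"
  unfolding ketbra_perp using assms
  by (intro cmat.subspace_diff noncommutative_graph_closed)

text \<open>The witnesses are \<open>w r = \<phi> + r c \<phi>'\<close>, where \<open>\<phi>' = perp \<phi>\<close> and \<open>c\<close> is an off-diagonal
  entry of a Hermitian element of \<open>S\<close> in the basis \<open>\<phi>, \<phi>'\<close>.\<close>

lemma many_rank_one_in_qubit_graph:
  fixes S :: "(complex^2^2) set"
  assumes S: "noncommutative_graph S" and \<phi>: "ketbra \<phi> \<phi> \<in> S" "\<phi> \<noteq> 0" and "2 \<notin> zero_error_sizes S"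
  obtains w :: "nat \<Rightarrow> complex^2" where "\<And>r. ketbra (w r) (w r) \<in> S"
    "\<And>r q. r \<noteq> q \<Longrightarrow> w r $ 1 * w q $ 2 \<noteq> w r $ 2 * w q $ 1"
proof -
  note cl = noncommutative_graph_closed[OF S]
  note add = cmat.subspace_add[OF cl(1)] and scale = cmat.subspace_scale[OF cl(1)]
    and diff = cmat.subspace_diff[OF cl(1)]
  define \<phi>' where "\<phi>' = perp \<phi>"
  have N: "sqnorm \<phi> \<noteq> 0" using \<phi>(2) by (simp add: sqnorm_eq_0_iff)
  have \<phi>': "ketbra \<phi>' \<phi>' \<in> S" using ketbra_perp_in_graph[OF S \<phi>(1)] by (simp add: \<phi>'_def)
  have "\<phi>' \<noteq> 0" using N det_perp[of \<phi>] by (auto simp: \<phi>'_def)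
  \<comment> \<open>If every element of \<open>S\<close> were diagonal in the basis
    \<open>\<phi>\<close>, \<open>\<phi>'\<close>, these two vectors would be an independent
    pair.\<close>
  have "\<not> (ketbra \<phi> \<phi>' \<bottom>\<^sub>S S \<and> ketbra \<phi>' \<phi> \<bottom>\<^sub>S S)"
  proof
    assume o: "ketbra \<phi> \<phi>' \<bottom>\<^sub>S S \<and> ketbra \<phi>' \<phi> \<bottom>\<^sub>S S"
    have "card (UNIV :: bool set) \<in> zero_error_sizes S"
      by (rule card_in_zero_error_sizes[where \<psi> = "\<lambda>b. if b then \<phi> else \<phi>'"])
        (use o \<phi>(2) \<open>\<phi>' \<noteq> 0\<close> in auto)
    then show False using \<open>2 \<notin> zero_error_sizes S\<close> by simp
  qed
  then obtain M where M: "M \<in> S" "hs_inner (ketbra \<phi> \<phi>') M \<noteq> 0"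
    unfolding hs_orthogonal_def using cl(2) hs_inner_ketbra_dagger
    by (metis complex_cnj_zero_iff)
  obtain X where X: "X \<in> S" "dagger X = X" "hs_inner (ketbra \<phi> \<phi>') X \<noteq> 0"
    using hermitian_witness[OF S, of M "hs_inner (ketbra \<phi> \<phi>')"] M
      hs_inner_add_right hs_inner_mscale_right by blast
  define c where "c = hs_inner (ketbra \<phi>' \<phi>) X"
  have cc: "hs_inner (ketbra \<phi> \<phi>') X = cnj c"
    using hs_inner_ketbra_dagger[of \<phi> \<phi>' X] X(2) by (simp add: c_def)
  have "c \<noteq> 0" using X(3) cc by auto
  \<comment> \<open>The diagonal part of \<open>X\<close> lies in \<open>S\<close>, so subtracting
    it leaves the off-diagonal part in \<open>S\<close>.\<close>
  have "cnj c *\<^sub>M ketbra \<phi> \<phi>' + c *\<^sub>M ketbra \<phi>' \<phi> =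
      (sqnorm \<phi> * sqnorm \<phi>) *\<^sub>M X - hs_inner (ketbra \<phi> \<phi>) X *\<^sub>M ketbra \<phi> \<phi>
        - hs_inner (ketbra \<phi>' \<phi>') X *\<^sub>M ketbra \<phi>' \<phi>'"
    using expand_in_perp_basis[of \<phi> X] by (simp add: cc c_def[symmetric] flip: \<phi>'_def)
  then have K: "cnj c *\<^sub>M ketbra \<phi> \<phi>' + c *\<^sub>M ketbra \<phi>' \<phi> \<in> S"
    using X(1) \<phi>(1) \<phi>' by (simp add: diff scale)
  define w where "w r = (\<chi> i. \<phi> $ i + of_nat r * c * \<phi>' $ i)" for r
  \<comment> \<open>The factor \<open>c\<close> in \<open>w r\<close> makes the cross terms exactly
    \<open>r\<close> times that off-diagonal part.\<close>
  have "ketbra (w r) (w r) = ketbra \<phi> \<phi> + of_nat r *\<^sub>M (cnj c *\<^sub>M ketbra \<phi> \<phi>' + c *\<^sub>M ketbra \<phi>' \<phi>)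
      + (of_nat r * of_nat r * c * cnj c) *\<^sub>M ketbra \<phi>' \<phi>'" for r
    by (simp add: w_def ketbra_def mscale_def vec_eq_iff algebra_simps)
  then have "ketbra (w r) (w r) \<in> S" for r
    using \<phi>(1) \<phi>' K by (simp add: add scale)
  moreover have "w r $ 1 * w q $ 2 \<noteq> w r $ 2 * w q $ 1" if "r \<noteq> q" for r q
  proof -
    have "w r $ 1 * w q $ 2 - w r $ 2 * w q $ 1
        = (of_nat q - of_nat r) * c * (\<phi> $ 1 * \<phi>' $ 2 - \<phi> $ 2 * \<phi>' $ 1)"
      by (simp add: w_def algebra_simps)
    also have "\<dots> \<noteq> 0"
      using that \<open>c \<noteq> 0\<close> N by (simp add: \<phi>'_def det_perp)
    finally show ?thesis by simp
  qed
  ultimately show thesis by (rule that)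
qed

section \<open>Submultiplicativity of \<alpha> and the conclusion\<close>

lemma alpha_tensor_qubit_le:
  fixes S :: "(complex^2^2) set" and T :: "(complex^'n^'n) set"
  assumes S: "noncommutative_graph S" and T: "noncommutative_graph T"
    and ne: "S \<noteq> {c *\<^sub>M mat 1 | c. True}"
  shows "alpha (S \<otimes>\<^sub>S T) \<le> alpha S * alpha T"
proof -
  define m where "m = alpha (S \<otimes>\<^sub>S T)"
  have "m \<in> zero_error_sizes (S \<otimes>\<^sub>S T)"
    unfolding m_def using noncommutative_graph_tensor[OF S T] by (rule alpha_attained)
  then obtain \<psi> :: "nat \<Rightarrow> complex^(2 \<times> 'n)" where nz: "\<And>s. s < m \<Longrightarrow> \<psi> s \<noteq> 0"
    and orth: "\<And>s t. s < m \<Longrightarrow> t < m \<Longrightarrow> s \<noteq> t \<Longrightarrow> ketbra (\<psi> s) (\<psi> t) \<bottom>\<^sub>S S \<otimes>\<^sub>S T"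
    unfolding zero_error_sizes_def by blast
  define A where "A \<phi> = {s. s < m \<and> contract \<phi> (\<psi> s) \<noteq> 0}" for \<phi>
  have A: "card (A \<phi>) \<le> alpha T" if "ketbra \<phi> \<phi> \<in> S" for \<phi>
    unfolding A_def using T that orth by (rule card_contract_le_alpha)
  obtain \<phi> where \<phi>: "\<phi> \<noteq> 0" "ketbra \<phi> \<phi> \<in> S"
    using rank_one_in_qubit_graph[OF S ne] by blast
  show ?thesis
  proof (cases "2 \<in> zero_error_sizes S")
    case True
    then have "2 \<le> alpha S" by (rule alpha_attained(3)[OF S])
    have "\<phi> $ 1 * perp \<phi> $ 2 \<noteq> \<phi> $ 2 * perp \<phi> $ 1"
      using det_perp[of \<phi>] \<phi>(1) by (auto simp: sqnorm_eq_0_iff)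
    then have "{..<m} \<subseteq> A \<phi> \<union> A (perp \<phi>)"
      using nz contract_2_eq_0 by (auto simp: A_def)
    then have "m \<le> card (A \<phi> \<union> A (perp \<phi>))"
      by (metis A_def card_lessThan card_mono finite_Collect_conjI finite_Collect_less_nat finite_UnI)
    also have "\<dots> \<le> card (A \<phi>) + card (A (perp \<phi>))" by (rule card_Un_le)
    also have "\<dots> \<le> 2 * alpha T"
      using A[OF \<phi>(2)] A[OF ketbra_perp_in_graph[OF S \<phi>(2)]] by simp
    also have "\<dots> \<le> alpha S * alpha T" using \<open>2 \<le> alpha S\<close> by simp
    finally show ?thesis unfolding m_def .
  next
    case False
    obtain w :: "nat \<Rightarrow> complex^2" where w: "\<And>r. ketbra (w r) (w r) \<in> S"
      "\<And>r q. r \<noteq> q \<Longrightarrow> w r $ 1 * w q $ 2 \<noteq> w r $ 2 * w q $ 1"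
      using many_rank_one_in_qubit_graph[OF S \<phi>(2,1) False] by blast
    \<comment> \<open>Two different \<open>w r\<close> cannot both kill the nonzero
      \<open>\<psi> s\<close>, so each \<open>s\<close> excludes at most one
      \<open>r\<close>.\<close>
    have "finite {r. contract (w r) (\<psi> s) = 0}" if "s < m" for s
    proof (cases "\<exists>q. contract (w q) (\<psi> s) = 0")
      case True
      then obtain q where "contract (w q) (\<psi> s) = 0" by blast
      then have "{r. contract (w r) (\<psi> s) = 0} \<subseteq> {q}"
        using contract_2_eq_0[OF w(2)] nz[OF that] by blast
      then show ?thesis by (rule finite_subset) simp
    qed simp
    then have "finite (\<Union>s<m. {r. contract (w r) (\<psi> s) = 0})" by blast
    then obtain r where "r \<notin> (\<Union>s<m. {r. contract (w r) (\<psi> s) = 0})"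
      using ex_new_if_finite infinite_UNIV_nat by blast
    then have "A (w r) = {..<m}" by (auto simp: A_def)
    then have "m \<le> alpha T" using A[OF w(1)[of r]] by simp
    also have "\<dots> \<le> alpha S * alpha T" using alpha_attained(2)[OF S] by simp
    finally show ?thesis unfolding m_def .
  qed
qed

theorem theorem6:
  fixes S :: "(complex^2^2) set" and T :: "(complex^'n^'n) set"
  assumes "noncommutative_graph S" and "noncommutative_graph T"
    and "capacity_activated S T"
  shows "S = {c *\<^sub>M mat 1 | c. True}"
proof (rule ccontr)
  assume "S \<noteq> {c *\<^sub>M mat 1 | c. True}"
  then have "real (alpha (S \<otimes>\<^sub>S T)) \<le> real (alpha S) * real (alpha T)"
    using alpha_tensor_qubit_le[OF assms(1,2)] by (simp flip: of_nat_mult)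
  moreover have pos: "alpha S \<ge> 1" "alpha T \<ge> 1" "alpha (S \<otimes>\<^sub>S T) \<ge> 1"
    using alpha_attained(2) assms(1,2) noncommutative_graph_tensor[OF assms(1,2)] by blast+
  \<comment> \<open>The logarithm turns the product bound into subadditivity of the capacity,
    against the strict inequality of activation.\<close>
  ultimately have "log 2 (alpha (S \<otimes>\<^sub>S T)) \<le> log 2 (real (alpha S) * real (alpha T))"
    by (intro log_mono) simp_all
  also have "\<dots> = log 2 (alpha S) + log 2 (alpha T)"
    using pos by (subst log_mult) auto
  finally show False
    using assms(3) by (simp add: capacity_activated_def zero_error_capacity_def)
qed

end
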